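(* For any $\lambda(\xi)\in\mathbb{C}[\xi]$ and $p(z)\in\mathbb{C}[z]$, one has $$\mathcal{R}(\lambda(\partial)\,p(z))=\lambda(\xi)\ast_{t=-1}p(z),\qquad \mathcal{L}(p(z)\,\lambda(\partial))=\lambda(\xi)\ast p(z),$$ where $\lambda(\partial)\,p(z)$ and $p(z)\,\lambda(\partial)$ denote compositions of differential operators, $p(z)$ being regarded as a multiplication operator.
   Context: Let $\xi=(\xi_1,\dots,\xi_n)$ and $z=(z_1,\dots,z_n)$ be $2n$ commuting free variables, $\partial_i=\partial/\partial z_i$, $\partial=(\partial_1,\dots,\partial_n)$, $\delta_i=\partial/\partial\xi_i$. For $t\in\mathbb{C}$ define on the vector space $\mathbb{C}[\xi,z]$ the product $f\ast_t g:=\mu\big(e^{-t\Omega}(f\otimes g)\big)$, where $\Omega=\sum_{i=1}^n(\partial_i\otimes\delta_i+\delta_i\otimes\partial_i)$ and $\mu(f\otimes g)=fg$ is the usual multiplication; $\ast:=\ast_{t=1}$. Let $\mathcal{D}[z]$ be the Weyl algebra of polynomial differential operators of $\mathbb{C}[z]$. Every $\phi\in\mathcal{D}[z]$ can be written uniquely as finite sums $\phi=\sum_{\alpha\in\mathbb{N}^n}a_\alpha(z)\partial^\alpha=\sum_{\beta\in\mathbb{N}^n}\partial^\beta b_\beta(z)$, where $a_\alpha(z),b_\beta(z)\in\mathbb{C}[z]$ stand for multiplication operators. The right total symbol of $\phi$ is $\mathcal{R}(\phi):=\sum_\alpha a_\alpha(z)\xi^\alpha\in\mathbb{C}[\xi,z]$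 and the left total symbol is $\mathcal{L}(\phi):=\sum_\beta b_\beta(z)\xi^\beta\in\mathbb{C}[\xi,z]$. *)

theory Defs
  imports Complex_Main "HOL-Library.Poly_Mapping"
begin

text \<open>
  \<open>'a \<Rightarrow>\<^sub>0 complex\<close> is the complex vector space with basis \<open>'a\<close>. A polynomial ring is
  the case where the basis consists of the monomials \<open>'v \<Rightarrow>\<^sub>0 nat\<close>; the multiplication
  of Poly_Mapping (convolution) is then the usual one. A finite type \<open>'n\<close> indexes the variables
  \<open>z\<^sub>1, \<dots>, z\<^sub>n\<close> and \<open>\<xi>\<^sub>1, \<dots>, \<xi>\<^sub>n\<close>.
\<close>

type_synonym 'v mpoly = "('v \<Rightarrow>\<^sub>0 nat) \<Rightarrow>\<^sub>0 complex"

datatype 'n var = Xi 'n | Z 'n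

definition smult :: "complex \<Rightarrow> ('a \<Rightarrow>\<^sub>0 complex) \<Rightarrow> ('a \<Rightarrow>\<^sub>0 complex)" where
  "smult c f = Poly_Mapping.map ((*) c) f"

text \<open>Relabelling of basis elements along \<open>h\<close>, extended linearly. It is used both for
  exponent vectors (renaming variables) and for polynomials (renaming monomials).\<close>

definition push :: "('a \<Rightarrow> 'b) \<Rightarrow> ('a \<Rightarrow>\<^sub>0 'c::comm_monoid_add) \<Rightarrow> ('b \<Rightarrow>\<^sub>0 'c)" where
  "push h f = (\<Sum>a\<in>Poly_Mapping.keys f. Poly_Mapping.single (h a) (Poly_Mapping.lookup f a))"

text \<open>The embeddings of \<open>\<complex>[\<xi>]\<close> and \<open>\<complex>[z]\<close> into \<open>\<complex>[\<xi>,z]\<close>.\<close>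

definition in_xi :: "'n mpoly \<Rightarrow> 'n var mpoly" where
  "in_xi = push (push Xi)"

definition in_z :: "'n mpoly \<Rightarrow> 'n var mpoly" where
  "in_z = push (push Z)"

text \<open>The truncated subtraction in the exponent is harmless: when the exponent of \<open>v\<close> is 0,
  the coefficient is 0.\<close>

definition pd :: "'v \<Rightarrow> 'v mpoly \<Rightarrow> 'v mpoly" where
  "pd v f = (\<Sum>m\<in>Poly_Mapping.keys f.
     Poly_Mapping.single (m - Poly_Mapping.single v 1)
       (of_nat (Poly_Mapping.lookup m v) * Poly_Mapping.lookup f m))"


section \<open>The products \<open>\<ast>\<^sub>t\<close>\<close>

text \<open>The tensor product of the spaces with bases \<open>'a\<close> and \<open>'b\<close> is the space with
  basis \<open>'a \<times> 'b\<close>, where \<open>(a, b)\<close> stands for \<open>a \<otimes> b\<close>.\<close>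

definition tensor :: "('a \<Rightarrow>\<^sub>0 complex) \<Rightarrow> ('b \<Rightarrow>\<^sub>0 complex) \<Rightarrow> ('a \<times> 'b \<Rightarrow>\<^sub>0 complex)" where
  "tensor f g = (\<Sum>a\<in>Poly_Mapping.keys f. \<Sum>b\<in>Poly_Mapping.keys g.
     Poly_Mapping.single (a, b) (Poly_Mapping.lookup f a * Poly_Mapping.lookup g b))"

text \<open>\<open>D \<otimes> E\<close> for linear operators \<open>D\<close> and \<open>E\<close>.\<close>

definition tensor_op ::
  "(('a \<Rightarrow>\<^sub>0 complex) \<Rightarrow> ('c \<Rightarrow>\<^sub>0 complex)) \<Rightarrow> (('b \<Rightarrow>\<^sub>0 complex) \<Rightarrow> ('d \<Rightarrow>\<^sub>0 complex)) \<Rightarrow>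
   ('a \<times> 'b \<Rightarrow>\<^sub>0 complex) \<Rightarrow> ('c \<times> 'd \<Rightarrow>\<^sub>0 complex)" where
  "tensor_op D E F = (\<Sum>(a, b)\<in>Poly_Mapping.keys F. smult (Poly_Mapping.lookup F (a, b))
     (tensor (D (Poly_Mapping.single a 1)) (E (Poly_Mapping.single b 1))))"

text \<open>The linear map \<open>f \<otimes> g \<mapsto> f g\<close>; on monomials, multiplication adds exponent vectors.\<close>

definition mu :: "(('v \<Rightarrow>\<^sub>0 nat) \<times> ('v \<Rightarrow>\<^sub>0 nat) \<Rightarrow>\<^sub>0 complex) \<Rightarrow> 'v mpoly" where
  "mu = push (\<lambda>(a, b). a + b)"

definition Omega ::
  "(('n::finite var \<Rightarrow>\<^sub>0 nat) \<times> ('n var \<Rightarrow>\<^sub>0 nat) \<Rightarrow>\<^sub>0 complex) \<Rightarrow>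
   (('n var \<Rightarrow>\<^sub>0 nat) \<times> ('n var \<Rightarrow>\<^sub>0 nat) \<Rightarrow>\<^sub>0 complex)" where
  "Omega F = (\<Sum>i\<in>UNIV. tensor_op (pd (Z i)) (pd (Xi i)) F + tensor_op (pd (Xi i)) (pd (Z i)) F)"

text \<open>\<open>e\<^bsup>sT\<^esup>\<close> for a locally nilpotent \<open>T\<close>. \<open>Sum_any\<close> is the sum over all
  \<open>k\<close> of a family with finitely many nonzero members.\<close>

definition exp_op :: "complex \<Rightarrow> (('a \<Rightarrow>\<^sub>0 complex) \<Rightarrow> ('a \<Rightarrow>\<^sub>0 complex)) \<Rightarrow>
    ('a \<Rightarrow>\<^sub>0 complex) \<Rightarrow> ('a \<Rightarrow>\<^sub>0 complex)" where
  "exp_op s T F = Sum_any (\<lambda>k::nat. smult (s ^ k / fact k) ((T ^^ k) F))"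

definition star :: "complex \<Rightarrow> 'n::finite var mpoly \<Rightarrow> 'n var mpoly \<Rightarrow> 'n var mpoly" where
  "star t f g = mu (exp_op (- t) Omega (tensor f g))"


section \<open>The Weyl algebra and total symbols\<close>

text \<open>The operators on \<open>\<complex>[z]\<close> generated by the multiplication operators and the
  \<open>\<partial>\<^sub>i\<close>.\<close>

inductive_set weyl_ops :: "('n mpoly \<Rightarrow> 'n mpoly) set" where
  mult: "(*) p \<in> weyl_ops"
| deriv: "pd i \<in> weyl_ops"
| add: "\<phi> \<in> weyl_ops \<Longrightarrow> \<psi> \<in> weyl_ops \<Longrightarrow> (\<lambda>f. \<phi> f + \<psi> f) \<in> weyl_ops"
| comp: "\<phi> \<in> weyl_ops \<Longrightarrow> \<psi> \<in> weyl_ops \<Longrightarrow> \<phi> \<circ> \<psi> \<in> weyl_ops"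

typedef 'n weyl = "weyl_ops :: ('n mpoly \<Rightarrow> 'n mpoly) set"
  morphisms weyl_apply Abs_weyl
  using weyl_ops.mult by blast

setup_lifting type_definition_weyl

lemma pd_superset:
  assumes "finite A" "Poly_Mapping.keys f \<subseteq> A"
  shows "pd v f = (\<Sum>m\<in>A. Poly_Mapping.single (m - Poly_Mapping.single v 1)
       (of_nat (Poly_Mapping.lookup m v) * Poly_Mapping.lookup f m))"
  unfolding pd_def
  by (rule sum.mono_neutral_left) (use assms in \<open>auto simp: in_keys_iff\<close>)

lemma pd_add: "pd v (f + g) = pd v f + pd v g"
proof -
  let ?A = "Poly_Mapping.keys f \<union> Poly_Mapping.keys g"
  have *: "finite ?A" "Poly_Mapping.keys (f + g) \<subseteq> ?A"
    "Poly_Mapping.keys f \<subseteq> ?A" "Poly_Mapping.keys g \<subseteq> ?A"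
    using Poly_Mapping.keys_add[of f g] by auto
  show ?thesis
    unfolding pd_superset[OF *(1,2)] pd_superset[OF *(1,3)] pd_superset[OF *(1,4)]
    by (simp add: lookup_add distrib_left single_add sum.distrib)
qed

lemma weyl_ops_additive: "\<phi> \<in> weyl_ops \<Longrightarrow> \<phi> (f + g) = \<phi> f + \<phi> g"
  by (induction arbitrary: f g rule: weyl_ops.induct)
     (simp_all add: distrib_left pd_add algebra_simps)

instantiation weyl :: (type) ring_1
begin

lift_definition zero_weyl :: "'a weyl" is "\<lambda>f. 0"
  using weyl_ops.mult[of 0] by (simp add: fun_eq_iff lambda_zero)
lift_definition one_weyl :: "'a weyl" is "\<lambda>f. f"
  using weyl_ops.mult[of 1] by (simp add: lambda_one)
lift_definition plus_weyl :: "'a weyl \<Rightarrow> 'a weyl \<Rightarrow> 'a weyl" is "\<lambda>\<phi> \<psi> f. \<phi> f + \<psi> f"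
  by (rule weyl_ops.add)
lift_definition uminus_weyl :: "'a weyl \<Rightarrow> 'a weyl" is "\<lambda>\<phi> f. - \<phi> f"
  using weyl_ops.comp[OF weyl_ops.mult[of "-1"]] by (simp add: comp_def)
lift_definition minus_weyl :: "'a weyl \<Rightarrow> 'a weyl \<Rightarrow> 'a weyl" is "\<lambda>\<phi> \<psi> f. \<phi> f - \<psi> f"
  using weyl_ops.add[OF _ weyl_ops.comp[OF weyl_ops.mult[of "-1"]]] by (simp add: comp_def)
lift_definition times_weyl :: "'a weyl \<Rightarrow> 'a weyl \<Rightarrow> 'a weyl" is "\<lambda>\<phi> \<psi>. \<phi> \<circ> \<psi>"
  by (rule weyl_ops.comp)

instance
proof
  have "(\<lambda>f::'a mpoly. 0) \<noteq> (\<lambda>f. f)"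
    by (metis zero_neq_one)
  then show "(0::'a weyl) \<noteq> 1"
    by transfer
qed (transfer; simp add: fun_eq_iff weyl_ops_additive algebra_simps)+

end

definition mult_op :: "'n mpoly \<Rightarrow> 'n weyl" where
  "mult_op p = Abs_weyl ((*) p)"

definition d_op :: "'n \<Rightarrow> 'n weyl" where
  "d_op i = Abs_weyl (pd i)"

text \<open>\<open>\<partial>\<^sup>\<alpha>\<close>. The Weyl algebra is not commutative, so the product over the variables
  is written as a fold; its order is irrelevant because the \<open>\<partial>\<^sub>i\<close> commute.\<close>

definition d_pow :: "('n::finite \<Rightarrow>\<^sub>0 nat) \<Rightarrow> 'n weyl" where
  "d_pow \<alpha> = Finite_Set.fold (\<lambda>i \<phi>. d_op i ^ Poly_Mapping.lookup \<alpha> i * \<phi>) 1 UNIV"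

text \<open>\<open>\<lambda>(\<partial>)\<close>: substitute \<open>\<partial>\<close> for the variables of \<open>\<lambda>\<close>. The scalar \<open>c\<close>
  is multiplication by the constant polynomial \<open>single 0 c\<close>.\<close>

definition subst_d :: "'n::finite mpoly \<Rightarrow> 'n weyl" where
  "subst_d l = (\<Sum>\<alpha>\<in>Poly_Mapping.keys l.
     mult_op (Poly_Mapping.single 0 (Poly_Mapping.lookup l \<alpha>)) * d_pow \<alpha>)"

text \<open>A finitely supported family \<open>(a\<^sub>\<alpha>)\<close> of polynomials in \<open>z\<close>, as an element of
  \<open>('n \<Rightarrow>\<^sub>0 nat) \<Rightarrow>\<^sub>0 'n mpoly\<close>, is unique in either representation below.\<close>

definition right_symbol :: "'n::finite weyl \<Rightarrow> 'n var mpoly" where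
  "right_symbol \<phi> =
     (let a = (THE a :: ('n \<Rightarrow>\<^sub>0 nat) \<Rightarrow>\<^sub>0 'n mpoly.
        \<phi> = (\<Sum>\<alpha>\<in>Poly_Mapping.keys a. mult_op (Poly_Mapping.lookup a \<alpha>) * d_pow \<alpha>))
      in \<Sum>\<alpha>\<in>Poly_Mapping.keys a.
        in_z (Poly_Mapping.lookup a \<alpha>) * in_xi (Poly_Mapping.single \<alpha> 1))"

definition left_symbol :: "'n::finite weyl \<Rightarrow> 'n var mpoly" where
  "left_symbol \<phi> =
     (let b = (THE b :: ('n \<Rightarrow>\<^sub>0 nat) \<Rightarrow>\<^sub>0 'n mpoly.
        \<phi> = (\<Sum>\<beta>\<in>Poly_Mapping.keys b. d_pow \<beta> * mult_op (Poly_Mapping.lookup b \<beta>)))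
      in \<Sum>\<beta>\<in>Poly_Mapping.keys b.
        in_z (Poly_Mapping.lookup b \<beta>) * in_xi (Poly_Mapping.single \<beta> 1))"

end

theory Submission
  imports Defs
begin

text \<open>
  Both identities hold because the two sides obey the same recursion in \<open>\<lambda>\<close>. Let
  \<open>\<lambda>\<close> be multiplied by a variable \<open>\<xi>\<^sub>i\<close>.

  On the side of the product \<open>\<ast>\<^sub>t\<close>, the commutator of \<open>\<Omega>\<close> with
  multiplication of the left factor by \<open>\<xi>\<^sub>i\<close> is \<open>1 \<otimes> \<partial>\<^sub>i\<close>, which
  commutes with \<open>\<Omega>\<close>. Exponentiating (\<open>exp_Omega_mult_left\<close>) gives
  \<open>(\<xi>\<^sub>i \<lambda>) \<ast>\<^sub>t p = \<xi>\<^sub>i (\<lambda> \<ast>\<^sub>t p) - t (\<lambda> \<ast>\<^sub>t \<partial>\<^sub>i p)\<close>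
  (\<open>star_xi_mult\<close>).

  On the side of the Weyl algebra, \<open>\<partial>\<^sub>i p = p \<partial>\<^sub>i + (\<partial>\<^sub>i p)\<close>
  (\<open>d_op_mult_op\<close>) gives
  \<open>(\<partial>\<^sub>i \<lambda>(\<partial>)) p = (\<lambda>(\<partial>) p) \<partial>\<^sub>i + \<lambda>(\<partial>) (\<partial>\<^sub>i p)\<close> and
  \<open>p (\<partial>\<^sub>i \<lambda>(\<partial>)) = \<partial>\<^sub>i (p \<lambda>(\<partial>)) - (\<partial>\<^sub>i p) \<lambda>(\<partial>)\<close>.
  Composing with \<open>\<partial>\<^sub>i\<close> on the right multiplies a right symbol by \<open>\<xi>\<^sub>i\<close>,
  and composing with it on the left multiplies a left symbol by \<open>\<xi>\<^sub>i\<close>. So the two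
  symbols satisfy the recursion for \<open>t = -1\<close> and for \<open>t = 1\<close>
  (\<open>right_family_exists\<close>, \<open>left_family_exists\<close>).

  A symbol is read off the coefficient family of an operator, and this family is unique
  (\<open>normal_ordering.extend_q_inject\<close>): the commutator with \<open>z\<^sub>i\<close>
  differentiates the symbol in \<open>\<xi>\<^sub>i\<close>, in either ordering, so by induction on the
  degree in \<open>\<xi>\<close> a family that represents the zero operator is a single multiplication
  operator, and that one vanishes at the polynomial 1.
\<close>

section \<open>Additive extension from basis elements\<close>

lemma poly_mapping_additive_induct [case_names single add]:
  fixes f :: "'a \<Rightarrow>\<^sub>0 'b::comm_monoid_add"
  assumes single: "\<And>a c. P (Poly_Mapping.single a c)"
    and add: "\<And>f g. P f \<Longrightarrow> P g \<Longrightarrow> P (f + g)"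
  shows "P f"
proof (induction f rule: Poly_Mapping.update_induct)
  case const
  show ?case using single[of undefined 0] by simp
next
  case (update f a b)
  have "Poly_Mapping.update a b f = f + Poly_Mapping.single a b"
    using update.hyps
    by (intro poly_mapping_eqI)
       (auto simp: lookup_update lookup_add lookup_single when_def in_keys_iff)
  then show ?case
    using add[OF update.IH single] by simp
qed

text \<open>
  The defining formulas of push, tensor, tensor_op, subst_d and of the two normal forms are all
  sums over the support of one argument. Each is an instance of this operator, so that one
  additivity lemma serves them all.
\<close>

definition extend :: "('a \<Rightarrow> 'b \<Rightarrow> 'c) \<Rightarrow> ('a \<Rightarrow>\<^sub>0 'b::zero) \<Rightarrow> 'c::comm_monoid_add" where
  "extend G f = (\<Sum>a\<in>Poly_Mapping.keys f. G a (Poly_Mapping.lookup f a))"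

lemma extend_zero [simp]: "extend G 0 = 0"
  by (simp add: extend_def)

lemma extend_single: "G a 0 = 0 \<Longrightarrow> extend G (Poly_Mapping.single a c) = G a c"
  by (cases "c = 0") (simp_all add: extend_def)

lemma extend_superset:
  assumes "\<And>a. G a 0 = 0" "finite A" "Poly_Mapping.keys f \<subseteq> A"
  shows "extend G f = (\<Sum>a\<in>A. G a (Poly_Mapping.lookup f a))"
  unfolding extend_def
  by (rule sum.mono_neutral_left) (use assms in \<open>auto simp: in_keys_iff\<close>)

lemma extend_add:
  assumes "\<And>a. G a 0 = 0" "\<And>a x y. G a (x + y) = G a x + G a y"
  shows "extend G (f + g) = extend G f + extend G g"
proof -
  let ?A = "Poly_Mapping.keys f \<union> Poly_Mapping.keys g"
  have *: "finite ?A" "Poly_Mapping.keys (f + g) \<subseteq> ?A"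
    "Poly_Mapping.keys f \<subseteq> ?A" "Poly_Mapping.keys g \<subseteq> ?A"
    using Poly_Mapping.keys_add[of f g] by auto
  note E = extend_superset[where G = G, OF assms(1) *(1)]
  show ?thesis
    unfolding E[OF *(2)] E[OF *(3)] E[OF *(4)]
    by (simp add: lookup_add assms(2) sum.distrib)
qed

text \<open>
  Exponent vectors are reached from 0 by raising one exponent by 1 at a time. The proof goes
  through the statement shifted by an arbitrary vector \<open>m0\<close>, because the summands of
  \<open>m\<close> are added one after the other to a vector that is not 0.
\<close>

lemma monomial_induct [case_names zero step]:
  fixes m :: "'v \<Rightarrow>\<^sub>0 nat"
  assumes zero: "P 0" and step: "\<And>m v. P m \<Longrightarrow> P (m + Poly_Mapping.single v 1)"
  shows "P m"
proof -
  have "P (m0 + m)" if "P m0" for m0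
    using that
  proof (induction m arbitrary: m0 rule: poly_mapping_additive_induct)
    case (single v k)
    then show ?case
    proof (induction k)
      case (Suc k)
      have "m0 + Poly_Mapping.single v (Suc k) =
          (m0 + Poly_Mapping.single v k) + Poly_Mapping.single v 1"
        by (simp add: add.assoc flip: single_add)
      then show ?case using step[OF Suc.IH[OF Suc.prems]] by simp
    qed simp
  next
    case (add f g)
    then show ?case by (simp flip: add.assoc)
  qed
  from this[OF zero] show ?thesis by simp
qed

section \<open>Polynomials and their partial derivatives\<close>

abbreviation const :: "complex \<Rightarrow> 'v mpoly" where
  "const c \<equiv> Poly_Mapping.single 0 c"

definition pvar :: "'v \<Rightarrow> 'v mpoly" where
  "pvar v = Poly_Mapping.single (Poly_Mapping.single v 1) 1"

text \<open>
  Every argument below that peels one variable off a polynomial rests on this induction.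
\<close>

lemma mpoly_induct [case_names const var add]:
  fixes f :: "'v mpoly"
  assumes const: "\<And>c. P (const c)"
    and var: "\<And>v f. P f \<Longrightarrow> P (pvar v * f)"
    and add: "\<And>f g. P f \<Longrightarrow> P g \<Longrightarrow> P (f + g)"
  shows "P f"
proof (induction f rule: poly_mapping_additive_induct)
  case (single m c)
  show ?case
  proof (induction m rule: monomial_induct)
    case (step m v)
    then show ?case
      using var[OF step, of v] by (simp add: pvar_def mult_single add.commute)
  qed (rule const)
qed (rule add)

lemma pd_single:
  "pd v (Poly_Mapping.single m c) =
    Poly_Mapping.single (m - Poly_Mapping.single v 1) (of_nat (Poly_Mapping.lookup m v) * c)"
  by (cases "c = 0") (simp_all add: pd_def)

lemma pd_const [simp]: "pd v (const c) = 0"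
  by (simp add: pd_single)

lemma pd_one [simp]: "pd v 1 = 0"
  using pd_const[of v 1] by simp

lemma pd_0 [simp]: "pd v 0 = 0"
  by (simp add: pd_def)

lemma pd_mult: "pd v (f * g) = pd v f * g + f * pd v g"
proof (induction f rule: poly_mapping_additive_induct)
  case (single m c)
  show ?case
  proof (induction g rule: poly_mapping_additive_induct)
    case (single n d)
    let ?e = "Poly_Mapping.single v (1::nat)"
    \<comment> \<open>Truncated subtraction associates with addition only where \<open>v\<close> occurs; elsewhere the
      coefficient of the term is 0.\<close>
    have 1: "m + n - ?e = m - ?e + n" if "Poly_Mapping.lookup m v \<noteq> 0"
      by (rule poly_mapping_eqI)
         (use that in \<open>auto simp: lookup_add lookup_minus lookup_single when_def\<close>)
    have 2: "m + n - ?e = m + (n - ?e)" if "Poly_Mapping.lookup n v \<noteq> 0"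
      by (rule poly_mapping_eqI)
         (use that in \<open>auto simp: lookup_add lookup_minus lookup_single when_def\<close>)
    show ?case
      using 1 2
      by (cases "Poly_Mapping.lookup m v = 0"; cases "Poly_Mapping.lookup n v = 0")
         (simp_all add: pd_single mult_single lookup_add algebra_simps flip: single_add)
  qed (simp add: pd_add algebra_simps)
qed (simp add: pd_add algebra_simps)

lemma pd_pvar: "pd v (pvar w) = (if v = w then 1 else 0)"
  by (simp add: pvar_def pd_single lookup_single flip: single_one)

lemma pd_commute: "pd v (pd w f) = pd w (pd v f)"
proof (induction f rule: mpoly_induct)
  case (var u f)
  then show ?case by (simp add: pd_mult pd_add pd_pvar algebra_simps)
qed (simp_all add: pd_add)

lemma lookup_smult [simp]: "Poly_Mapping.lookup (smult c f) a = c * Poly_Mapping.lookup f a"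
  by (simp add: smult_def map.rep_eq when_def)

lemma smult_add: "smult c (f + g) = smult c f + smult c g"
  by (rule poly_mapping_eqI) (simp add: lookup_add algebra_simps)

lemma smult_single: "smult c (Poly_Mapping.single a d) = Poly_Mapping.single a (c * d)"
  by (rule poly_mapping_eqI) (simp add: lookup_single when_def)

lemma smult_conv_mult: "smult c f = const c * (f :: 'v mpoly)"
  by (induction f rule: poly_mapping_additive_induct)
     (simp_all add: smult_add smult_single mult_single algebra_simps)

section \<open>The tensor product\<close>

lemma smult_zero [simp]: "smult c 0 = 0" "smult 0 f = 0"
  by (rule poly_mapping_eqI; simp)+

lemma smult_one [simp]: "smult 1 f = f"
  by (rule poly_mapping_eqI) simp

lemma smult_smult [simp]: "smult c (smult d f) = smult (c * d) f"
  by (rule poly_mapping_eqI) simp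

lemma smult_add_left: "smult (c + d) f = smult c f + smult d f"
  by (rule poly_mapping_eqI) (simp add: lookup_add algebra_simps)

lemma smult_minus_one: "smult (- 1) f = - f"
  by (rule poly_mapping_eqI) simp

lemma smult_sum: "smult c (sum F A) = (\<Sum>x\<in>A. smult c (F x))"
  by (induction A rule: infinite_finite_induct) (simp_all add: smult_add)

lemma push_conv_extend: "push h f = extend (\<lambda>a c. Poly_Mapping.single (h a) c) f"
  by (simp add: push_def extend_def)

lemma push_single [simp]: "push h (Poly_Mapping.single a c) = Poly_Mapping.single (h a) c"
  by (simp add: push_conv_extend extend_single)

lemma push_zero [simp]: "push h 0 = 0"
  by (simp add: push_conv_extend)

lemma push_add: "push h (f + g) = push h f + push h g"
  unfolding push_conv_extend by (rule extend_add) (simp_all add: single_add)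

lemma push_smult: "push h (smult c f) = smult c (push h f)"
  by (induction f rule: poly_mapping_additive_induct)
     (simp_all add: smult_add push_add smult_single)

lemma tensor_conv_extend:
  "tensor f g = extend (\<lambda>a c. extend (\<lambda>b d. Poly_Mapping.single (a, b) (c * d)) g) f"
  by (simp add: tensor_def extend_def)

lemma tensor_single:
  "tensor (Poly_Mapping.single a c) (Poly_Mapping.single b d) = Poly_Mapping.single (a, b) (c * d)"
  by (subst tensor_conv_extend) (simp add: extend_single extend_def)

lemma tensor_add_left: "tensor (f + g) h = tensor f h + tensor g h"
  unfolding tensor_conv_extend
  by (rule extend_add) (simp_all add: extend_def algebra_simps single_add sum.distrib)

lemma tensor_add_right: "tensor f (g + h) = tensor f g + tensor f h"
proof -
  have "extend (\<lambda>b d. Poly_Mapping.single (a, b) (c * d)) (g + h) =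
      extend (\<lambda>b d. Poly_Mapping.single (a, b) (c * d)) g +
      extend (\<lambda>b d. Poly_Mapping.single (a, b) (c * d)) h" for a :: 'a and c
    by (rule extend_add) (simp_all add: algebra_simps single_add)
  then show ?thesis
    by (simp add: tensor_conv_extend) (simp add: extend_def sum.distrib)
qed

lemma tensor_zero [simp]: "tensor 0 g = 0" "tensor f 0 = 0"
  by (simp_all add: tensor_def)

lemma tensor_smult: "tensor (smult c f) (smult d g) = smult (c * d) (tensor f g)"
proof (induction f rule: poly_mapping_additive_induct)
  case (single a x)
  show ?case
    by (induction g rule: poly_mapping_additive_induct)
       (simp_all add: smult_single tensor_single smult_add tensor_add_right algebra_simps)
qed (simp add: smult_add tensor_add_left)

lemma tensor_smult_left: "tensor (smult c f) g = smult c (tensor f g)"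
  using tensor_smult[of c f 1 g] by simp

text \<open>
  Additive identities between operators on the tensor product may be checked on pure tensors.
\<close>

lemma tensor_induct [case_names tensor add]:
  assumes "\<And>f g. P (tensor f g)" "\<And>F G. P F \<Longrightarrow> P G \<Longrightarrow> P (F + G)"
  shows "P F"
proof (induction F rule: poly_mapping_additive_induct)
  case (single x c)
  show ?case
    using assms(1)[of "Poly_Mapping.single (fst x) c" "Poly_Mapping.single (snd x) 1"]
    by (simp add: tensor_single)
qed (rule assms(2))

lemma tensor_op_conv_extend:
  "tensor_op D E F = extend (\<lambda>x c. smult c
     (tensor (D (Poly_Mapping.single (fst x) 1)) (E (Poly_Mapping.single (snd x) 1)))) F"
  by (simp add: tensor_op_def extend_def case_prod_beta)

lemma tensor_op_add: "tensor_op D E (F + G) = tensor_op D E F + tensor_op D E G"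
  unfolding tensor_op_conv_extend
  by (rule extend_add) (simp_all add: smult_add_left)

definition linear_op :: "(('a \<Rightarrow>\<^sub>0 complex) \<Rightarrow> ('b \<Rightarrow>\<^sub>0 complex)) \<Rightarrow> bool" where
  "linear_op D \<longleftrightarrow> (\<forall>f g. D (f + g) = D f + D g) \<and> (\<forall>c f. D (smult c f) = smult c (D f))"

lemma linear_op_id [simp]: "linear_op (\<lambda>f. f)"
  by (simp add: linear_op_def)

lemma linear_op_mult [simp]: "linear_op ((*) (p :: 'v mpoly))"
  by (simp add: linear_op_def smult_conv_mult algebra_simps)

lemma pd_smult: "pd v (smult c f) = smult c (pd v f)"
  by (simp add: smult_conv_mult pd_mult)

lemma linear_op_pd [simp]: "linear_op (pd v)"
  by (simp add: linear_op_def pd_add pd_smult)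

text \<open>
  \<open>D \<otimes> E\<close> is defined through basis elements; homogeneity of \<open>D\<close> and \<open>E\<close> is what
  lets the two coefficients be pulled out.
\<close>

lemma tensor_op_tensor:
  assumes D: "linear_op D" and E: "linear_op E"
  shows "tensor_op D E (tensor f g) = tensor (D f) (E g)"
proof (induction f rule: poly_mapping_additive_induct)
  case (single a c)
  show ?case
  proof (induction g rule: poly_mapping_additive_induct)
    case (single b d)
    have "tensor (D (Poly_Mapping.single a c)) (E (Poly_Mapping.single b d)) =
        tensor (D (smult c (Poly_Mapping.single a 1))) (E (smult d (Poly_Mapping.single b 1)))"
      by (simp add: smult_single)
    also have "\<dots> = smult (c * d) (tensor (D (Poly_Mapping.single a 1)) (E (Poly_Mapping.single b 1)))"
      using D E by (simp add: linear_op_def tensor_smult)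
    finally show ?case
      by (simp add: tensor_single tensor_op_conv_extend extend_single)
  next
    case (add g h)
    then show ?case
      using E by (simp add: linear_op_def tensor_add_right tensor_op_add)
  qed
next
  case (add f h)
  then show ?case
    using D by (simp add: linear_op_def tensor_add_left tensor_op_add)
qed

lemma mu_tensor: "mu (tensor f g) = f * g"
proof (induction f rule: poly_mapping_additive_induct)
  case (single a x)
  show ?case
    by (induction g rule: poly_mapping_additive_induct)
       (simp_all add: mu_def push_add tensor_single mult_single tensor_add_right algebra_simps)
qed (simp add: mu_def push_add tensor_add_left algebra_simps)

lemma mu_add: "mu (F + G) = mu F + mu G"
  by (simp add: mu_def push_add)

lemma mu_smult: "mu (smult c F) = smult c (mu F)"
  by (simp add: mu_def push_smult)

section \<open>The operator \<open>\<Omega>\<close>\<close>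

text \<open>
  Pairing each variable with its partner writes \<open>\<Omega>\<close> as a single sum over all \<open>2 n\<close>
  variables and removes the distinction between \<open>\<xi>\<close> and \<open>z\<close> from the recursion for
  \<open>\<ast>\<^sub>t\<close>.
\<close>

fun dual :: "'n var \<Rightarrow> 'n var" where
  "dual (Xi i) = Z i"
| "dual (Z i) = Xi i"

lemma UNIV_var: "(UNIV :: 'n var set) = range Xi \<union> range Z"
proof -
  have "v \<in> range Xi \<union> range Z" for v :: "'n var"
    by (cases v) auto
  then show ?thesis by auto
qed

instance var :: (finite) finite
  by standard (simp add: UNIV_var)

lemma Omega_eq_sum_dual: "Omega F = (\<Sum>v\<in>UNIV. tensor_op (pd v) (pd (dual v)) F)"
proof -
  have "(\<Sum>v\<in>UNIV. tensor_op (pd v) (pd (dual v)) F) =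
      (\<Sum>v\<in>range Xi. tensor_op (pd v) (pd (dual v)) F) +
      (\<Sum>v\<in>range Z. tensor_op (pd v) (pd (dual v)) F)"
    unfolding UNIV_var by (rule sum.union_disjoint) auto
  also have "\<dots> = (\<Sum>i\<in>UNIV. tensor_op (pd (Xi i)) (pd (Z i)) F) +
      (\<Sum>i\<in>UNIV. tensor_op (pd (Z i)) (pd (Xi i)) F)"
    by (simp add: sum.reindex inj_def)
  finally show ?thesis
    by (simp add: Omega_def sum.distrib add.commute)
qed

lemma Omega_add: "Omega (F + G) = Omega F + Omega G"
  by (simp add: Omega_def tensor_op_add sum.distrib algebra_simps)

lemma Omega_tensor: "Omega (tensor f g) = (\<Sum>v\<in>UNIV. tensor (pd v f) (pd (dual v) g))"
  by (simp add: Omega_eq_sum_dual tensor_op_tensor)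

lemma Omega_zero [simp]: "Omega 0 = 0"
  by (simp add: Omega_def tensor_op_def)

lemma Omega_smult: "Omega (smult c F) = smult c (Omega F)"
proof (induction F rule: tensor_induct)
  case (tensor f g)
  have "Omega (smult c (tensor f g)) = Omega (tensor (smult c f) g)"
    by (simp add: tensor_smult_left)
  also have "\<dots> = (\<Sum>v\<in>UNIV. tensor (smult c (pd v f)) (pd (dual v) g))"
    by (simp add: Omega_tensor pd_smult)
  also have "\<dots> = smult c (Omega (tensor f g))"
    by (simp add: Omega_tensor smult_sum tensor_smult_left)
  finally show ?case .
qed (simp add: smult_add Omega_add)

lemma Omega_pow_zero [simp]: "(Omega ^^ k) 0 = 0"
  by (induction k) simp_all

lemma Omega_pow_add: "(Omega ^^ k) (F + G) = (Omega ^^ k) F + (Omega ^^ k) G"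
  by (induction k) (simp_all add: Omega_add)

definition mult_left where
  "mult_left v = tensor_op ((*) (pvar v)) (\<lambda>g :: 'v mpoly. g)"

definition pd_right where
  "pd_right v = tensor_op (\<lambda>f :: 'v mpoly. f) (pd v)"

lemma mult_left_tensor: "mult_left v (tensor f g) = tensor (pvar v * f) g"
  unfolding mult_left_def by (subst tensor_op_tensor) simp_all

lemma pd_right_tensor: "pd_right v (tensor f g) = tensor f (pd v g)"
  unfolding pd_right_def by (subst tensor_op_tensor) simp_all

lemma mult_left_add: "mult_left v (F + G) = mult_left v F + mult_left v G"
  by (simp add: mult_left_def tensor_op_add)

lemma pd_right_add: "pd_right v (F + G) = pd_right v F + pd_right v G"
  by (simp add: pd_right_def tensor_op_add)

lemma mult_left_smult: "mult_left v (smult c F) = smult c (mult_left v F)"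
proof (induction F rule: tensor_induct)
  case (tensor f g)
  have "pvar v * smult c f = smult c (pvar v * f)"
    by (simp add: smult_conv_mult mult.left_commute)
  then show ?case
    by (simp only: mult_left_tensor flip: tensor_smult_left)
qed (simp add: smult_add mult_left_add)

lemma mult_left_zero [simp]: "mult_left v 0 = 0"
  by (simp add: mult_left_def tensor_op_def)

lemma pd_right_zero [simp]: "pd_right v 0 = 0"
  by (simp add: pd_right_def tensor_op_def)

lemma mult_left_sum: "mult_left v (sum F A) = (\<Sum>x\<in>A. mult_left v (F x))"
  by (induction A rule: infinite_finite_induct) (simp_all add: mult_left_add)

lemma pd_right_sum: "pd_right v (sum F A) = (\<Sum>x\<in>A. pd_right v (F x))"
  by (induction A rule: infinite_finite_induct) (simp_all add: pd_right_add)

lemma mu_mult_left: "mu (mult_left v F) = pvar v * mu F"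
  by (induction F rule: tensor_induct)
     (simp_all add: mult_left_tensor mu_tensor mult_left_add mu_add algebra_simps)

text \<open>
  The commutator of \<open>\<Omega>\<close> with \<open>v \<otimes> 1\<close>: by the Leibniz rule only the summand
  of \<open>\<Omega>\<close> that differentiates the left factor in \<open>v\<close> contributes, and its other
  half differentiates the right factor in the partner of \<open>v\<close>.
\<close>

lemma Omega_mult_left: "Omega (mult_left v F) = mult_left v (Omega F) + pd_right (dual v) F"
proof (induction F rule: tensor_induct)
  case (tensor f g)
  have "tensor (pd w (pvar v * f)) (pd (dual w) g) =
      tensor (pvar v * pd w f) (pd (dual w) g) + (if w = v then tensor f (pd (dual v) g) else 0)"
    for w
    by (simp add: pd_mult pd_pvar tensor_add_left add.commute)
  then show ?case
    by (simp add: mult_left_tensor pd_right_tensor Omega_tensor mult_left_sum sum.distrib)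
qed (simp add: mult_left_add pd_right_add Omega_add algebra_simps)

lemma Omega_pd_right: "Omega (pd_right v F) = pd_right v (Omega F)"
  by (induction F rule: tensor_induct)
     (simp_all add: pd_right_tensor Omega_tensor pd_right_sum pd_right_add Omega_add pd_commute[of v])

lemma Omega_pow_pd_right: "(Omega ^^ k) (pd_right v F) = pd_right v ((Omega ^^ k) F)"
  by (induction k) (simp_all add: Omega_pd_right)

text \<open>
  \<open>[A\<^sup>k, B] = k A\<^bsup>k - 1\<^esup> [A, B]\<close> whenever \<open>A\<close> commutes with
  \<open>[A, B]\<close>; the exponent is \<open>k + 1\<close> to avoid \<open>k - 1\<close>.
\<close>

lemma Omega_pow_mult_left:
  "(Omega ^^ Suc k) (mult_left v F) = mult_left v ((Omega ^^ Suc k) F) +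
     smult (of_nat (Suc k)) ((Omega ^^ k) (pd_right (dual v) F))"
proof (induction k)
  case 0
  then show ?case by (simp add: Omega_mult_left)
next
  case (Suc k)
  have "(Omega ^^ Suc (Suc k)) (mult_left v F) = Omega ((Omega ^^ Suc k) (mult_left v F))"
    by simp
  also have "\<dots> = mult_left v ((Omega ^^ Suc (Suc k)) F) + pd_right (dual v) ((Omega ^^ Suc k) F) +
      smult (of_nat (Suc k)) ((Omega ^^ Suc k) (pd_right (dual v) F))"
    unfolding Suc.IH by (simp add: Omega_add Omega_mult_left Omega_smult)
  also have "pd_right (dual v) ((Omega ^^ Suc k) F) = smult 1 ((Omega ^^ Suc k) (pd_right (dual v) F))"
    by (simp only: Omega_pow_pd_right smult_one)
  finally show ?case
    by (simp only: add.assoc flip: smult_add_left) (simp add: algebra_simps)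
qed

section \<open>The exponential of \<open>\<Omega>\<close>\<close>

lemma exp_op_eq_sum:
  assumes "\<And>k. k \<ge> N \<Longrightarrow> (T ^^ k) F = 0"
  shows "exp_op s T F = (\<Sum>k<N. smult (s ^ k / fact k) ((T ^^ k) F))"
  unfolding exp_op_def
proof (rule Sum_any.expand_superset)
  show "{k. smult (s ^ k / fact k) ((T ^^ k) F) \<noteq> 0} \<subseteq> {..<N}"
  proof
    fix k assume "k \<in> {k. smult (s ^ k / fact k) ((T ^^ k) F) \<noteq> 0}"
    then have "(T ^^ k) F \<noteq> 0" by auto
    with assms[of k] show "k \<in> {..<N}" by (cases "k < N") auto
  qed
qed simp

definition nilpotent_at :: "('a \<Rightarrow> 'a::zero) \<Rightarrow> 'a \<Rightarrow> bool" where
  "nilpotent_at T F \<longleftrightarrow> (\<forall>\<^sub>F k in sequentially. (T ^^ k) F = 0)"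

lemma nilpotent_at_mult_left:
  assumes "nilpotent_at Omega F"
  shows "nilpotent_at Omega (mult_left v F)"
proof -
  from assms have 1: "\<forall>\<^sub>F k in sequentially. (Omega ^^ k) F = 0"
    by (simp add: nilpotent_at_def)
  then have "\<forall>\<^sub>F k in sequentially. (Omega ^^ Suc k) F = 0"
    by (rule eventually_sequentially_Suc[THEN iffD2])
  with 1 have "\<forall>\<^sub>F k in sequentially. (Omega ^^ Suc k) (mult_left v F) = 0"
    by eventually_elim (simp add: Omega_pow_mult_left Omega_pow_pd_right del: funpow.simps)
  then show ?thesis
    unfolding nilpotent_at_def by (subst (asm) eventually_sequentially_Suc)
qed

lemma nilpotent_at_add:
  assumes "nilpotent_at Omega F" "nilpotent_at Omega G"
  shows "nilpotent_at Omega (F + G)"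
  using assms unfolding nilpotent_at_def by eventually_elim (simp add: Omega_pow_add)

lemma Omega_tensor_const [simp]: "Omega (tensor (const c) g) = 0"
  by (simp add: Omega_tensor)

text \<open>
  The commutator formula for powers passes nilpotency from \<open>F\<close> to
  \<open>(v \<otimes> 1) F\<close>, and \<open>\<Omega>\<close> kills \<open>c \<otimes> g\<close> for a constant \<open>c\<close>. So
  induction on the left factor suffices.
\<close>

lemma Omega_locally_nilpotent: "nilpotent_at Omega F"
proof (induction F rule: tensor_induct)
  case (tensor f g)
  show ?case
  proof (induction f rule: mpoly_induct)
    case (const c)
    have "(Omega ^^ k) (tensor (const c) g) = 0" if "k \<ge> 1" for k
      using that by (cases k) (simp_all del: funpow.simps add: funpow_Suc_right)
    then show ?case
      unfolding nilpotent_at_def eventually_sequentially by blast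
  next
    case (var v f)
    then show ?case
      using nilpotent_at_mult_left by (simp flip: mult_left_tensor)
  qed (simp add: tensor_add_left nilpotent_at_add)
qed (rule nilpotent_at_add)

text \<open>
  Every sufficiently long partial sum is the exponential, so that several exponentials can be
  truncated at a common length.
\<close>

lemma exp_Omega_eq_sum:
  obtains N where "\<And>M. M \<ge> N \<Longrightarrow> exp_op s Omega F = (\<Sum>k<M. smult (s ^ k / fact k) ((Omega ^^ k) F))"
proof -
  from Omega_locally_nilpotent[of F] obtain N where "\<forall>k\<ge>N. (Omega ^^ k) F = 0"
    by (auto simp: nilpotent_at_def eventually_sequentially)
  then show ?thesis
    by (intro that[of N] exp_op_eq_sum) auto
qed

lemma exp_Omega_add: "exp_op s Omega (F + G) = exp_op s Omega F + exp_op s Omega G"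
proof -
  obtain A where A: "\<And>M. M \<ge> A \<Longrightarrow> exp_op s Omega F = (\<Sum>k<M. smult (s ^ k / fact k) ((Omega ^^ k) F))"
    using exp_Omega_eq_sum[of s F] by blast
  obtain B where B: "\<And>M. M \<ge> B \<Longrightarrow> exp_op s Omega G = (\<Sum>k<M. smult (s ^ k / fact k) ((Omega ^^ k) G))"
    using exp_Omega_eq_sum[of s G] by blast
  obtain C where C: "\<And>M. M \<ge> C \<Longrightarrow> exp_op s Omega (F + G) = (\<Sum>k<M. smult (s ^ k / fact k) ((Omega ^^ k) (F + G)))"
    using exp_Omega_eq_sum[of s "F + G"] by blast
  let ?M = "max A (max B C)"
  have "exp_op s Omega F = (\<Sum>k<?M. smult (s ^ k / fact k) ((Omega ^^ k) F))"
    "exp_op s Omega G = (\<Sum>k<?M. smult (s ^ k / fact k) ((Omega ^^ k) G))"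
    "exp_op s Omega (F + G) = (\<Sum>k<?M. smult (s ^ k / fact k) ((Omega ^^ k) (F + G)))"
    by (rule A B C; simp)+
  then show ?thesis
    by (simp only: Omega_pow_add smult_add sum.distrib)
qed

text \<open>
  \<open>e\<^bsup>sA\<^esup> B = (B + s [A, B]) e\<^bsup>sA\<^esup>\<close> when \<open>[A, B]\<close> commutes with
  \<open>A\<close>. The proof compares coefficients of \<open>s\<close>, using \<open>(k + 1) / (k + 1)! = 1 / k!\<close>.
\<close>

lemma exp_Omega_mult_left:
  "exp_op s Omega (mult_left v F) =
     mult_left v (exp_op s Omega F) + smult s (exp_op s Omega (pd_right (dual v) F))"
proof -
  let ?Y = "pd_right (dual v) F" and ?c = "\<lambda>k. s ^ k / fact k"
  obtain A where A: "\<And>M. M \<ge> A \<Longrightarrow> exp_op s Omega F = (\<Sum>k<M. smult (?c k) ((Omega ^^ k) F))"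
    using exp_Omega_eq_sum[of s F] by blast
  obtain B where B: "\<And>M. M \<ge> B \<Longrightarrow> exp_op s Omega ?Y = (\<Sum>k<M. smult (?c k) ((Omega ^^ k) ?Y))"
    using exp_Omega_eq_sum[of s ?Y] by blast
  obtain C where C: "\<And>M. M \<ge> C \<Longrightarrow> exp_op s Omega (mult_left v F) =
      (\<Sum>k<M. smult (?c k) ((Omega ^^ k) (mult_left v F)))"
    using exp_Omega_eq_sum[of s "mult_left v F"] by blast
  let ?M = "max A (max B C)"
  \<comment> \<open>The sum for \<open>?Y\<close> is one term shorter, because \<open>Omega_pow_mult_left\<close> lowers the
    exponent of the commutator term by 1.\<close>
  have eqs: "exp_op s Omega F = (\<Sum>k<Suc ?M. smult (?c k) ((Omega ^^ k) F))"
    "exp_op s Omega ?Y = (\<Sum>k<?M. smult (?c k) ((Omega ^^ k) ?Y))"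
    "exp_op s Omega (mult_left v F) = (\<Sum>k<Suc ?M. smult (?c k) ((Omega ^^ k) (mult_left v F)))"
    by (rule A B C; simp)+
  have coeff: "?c (Suc k) * of_nat (Suc k) = s * ?c k" for k
    by (simp add: field_simps del: of_nat_Suc)
  have "smult (?c (Suc k)) ((Omega ^^ Suc k) (mult_left v F)) =
      mult_left v (smult (?c (Suc k)) ((Omega ^^ Suc k) F)) + smult s (smult (?c k) ((Omega ^^ k) ?Y))"
    for k
    unfolding Omega_pow_mult_left smult_add mult_left_smult smult_smult coeff ..
  then show ?thesis
    unfolding eqs sum.lessThan_Suc_shift
    by (simp only: mult_left_sum smult_sum mult_left_add sum.distrib funpow_0 mult_left_smult add.assoc)
qed

section \<open>The product \<open>\<ast>\<^sub>t\<close> by recursion on the left factor\<close>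

lemma star_const: "star t (const c) g = const c * g"
proof -
  have "exp_op (- t) Omega (tensor (const c) g) = (\<Sum>k<1. smult ((- t) ^ k / fact k) ((Omega ^^ k) (tensor (const c) g)))"
  proof (rule exp_op_eq_sum)
    show "(Omega ^^ k) (tensor (const c) g) = 0" if "k \<ge> 1" for k
      using that by (cases k) (simp_all del: funpow.simps add: funpow_Suc_right)
  qed
  then show ?thesis by (simp add: star_def mu_tensor)
qed

lemma star_add_left: "star t (f + g) h = star t f h + star t g h"
  by (simp add: star_def tensor_add_left exp_Omega_add mu_add)

text \<open>
  The recursion holds for all polynomials in \<open>\<xi>\<close> and \<open>z\<close>. Together with
  \<open>star_const\<close> and \<open>star_add_left\<close> it determines \<open>\<ast>\<^sub>t\<close>.
\<close>

lemma star_pvar_mult: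
  "star t (pvar v * f) g = pvar v * star t f g - smult t (star t f (pd (dual v) g))"
  by (simp add: star_def exp_Omega_mult_left mu_add mu_mult_left mu_smult pd_right_tensor
      smult_conv_mult single_uminus flip: mult_left_tensor)

section \<open>The embeddings of \<open>\<complex>[\<xi>]\<close> and \<open>\<complex>[z]\<close>\<close>

lemma push_mult:
  fixes f g :: "'a::monoid_add \<Rightarrow>\<^sub>0 'c::comm_semiring_0"
  assumes "\<And>a b. h (a + b) = h a + (h b :: 'b::monoid_add)"
  shows "push h (f * g) = push h f * push h g"
proof (induction f rule: poly_mapping_additive_induct)
  case (single a x)
  show ?case
    by (induction g rule: poly_mapping_additive_induct)
       (simp_all add: assms push_add mult_single algebra_simps)
qed (simp add: push_add algebra_simps)

lemma in_xi_add: "in_xi (f + g) = in_xi f + in_xi g"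
  and in_z_add: "in_z (f + g) = in_z f + in_z g"
  by (simp_all add: in_xi_def in_z_def push_add)

lemma in_xi_mult: "in_xi (f * g) = in_xi f * in_xi g"
  and in_z_mult: "in_z (f * g) = in_z f * in_z g"
  by (simp_all add: in_xi_def in_z_def push_mult push_add)

lemma in_xi_const [simp]: "in_xi (const c) = const c"
  and in_z_const [simp]: "in_z (const c) = const c"
  by (simp_all add: in_xi_def in_z_def)

lemma in_xi_pvar [simp]: "in_xi (pvar i) = pvar (Xi i)"
  and in_z_pvar [simp]: "in_z (pvar i) = pvar (Z i)"
  by (simp_all only: in_xi_def in_z_def pvar_def push_single)

lemma in_z_zero [simp]: "in_z 0 = 0"
  by (simp add: in_z_def)

lemma in_xi_one [simp]: "in_xi 1 = 1"
  and in_z_one [simp]: "in_z 1 = 1"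
  using in_xi_const[of 1] in_z_const[of 1] by simp_all

lemma pd_in_z: "pd (Z i) (in_z p) = in_z (pd i p)"
  by (induction p rule: mpoly_induct)
     (simp_all add: in_z_add in_z_mult pd_add pd_mult pd_pvar)

section \<open>Relations in the Weyl algebra\<close>

lemma weyl_apply_mult_op [simp]: "weyl_apply (mult_op p) = (*) p"
  by (simp add: mult_op_def Abs_weyl_inverse weyl_ops.mult)

lemma weyl_apply_d_op [simp]: "weyl_apply (d_op i) = pd i"
  by (simp add: d_op_def Abs_weyl_inverse weyl_ops.deriv)

lemma weyl_eqI: "(\<And>f. weyl_apply \<phi> f = weyl_apply \<psi> f) \<Longrightarrow> \<phi> = \<psi>"
  by (simp add: weyl_apply_inject[symmetric] fun_eq_iff)

lemma mult_op_add: "mult_op (p + q) = mult_op p + mult_op q"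
  and mult_op_mult: "mult_op (p * q) = mult_op p * mult_op q"
  and mult_op_zero [simp]: "mult_op 0 = 0"
  and mult_op_one [simp]: "mult_op 1 = 1"
  by (rule weyl_eqI; simp add: plus_weyl.rep_eq times_weyl.rep_eq zero_weyl.rep_eq
      one_weyl.rep_eq algebra_simps)+

lemma mult_op_commute: "mult_op p * mult_op q = mult_op q * mult_op p"
  by (metis mult.commute mult_op_mult)

lemma mult_op_of_nat: "mult_op (of_nat n) = of_nat n"
  by (induction n) (simp_all add: mult_op_add)

lemma mult_op_eq_0_iff [simp]: "mult_op p = 0 \<longleftrightarrow> p = 0"
proof
  assume "mult_op p = 0"
  then have "weyl_apply (mult_op p) 1 = weyl_apply 0 1" by simp
  then show "p = 0" by (simp add: zero_weyl.rep_eq)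
qed simp

lemma d_op_mult_op: "d_op i * mult_op p = mult_op p * d_op i + mult_op (pd i p)"
  by (rule weyl_eqI) (simp add: plus_weyl.rep_eq times_weyl.rep_eq pd_mult)

lemma d_op_commute: "d_op i * d_op j = d_op j * d_op i"
  by (rule weyl_eqI) (simp add: times_weyl.rep_eq pd_commute[of i])

lemma d_pow_zero [simp]: "d_pow 0 = 1"
proof -
  have "Finite_Set.fold (\<lambda>i \<phi> :: 'a weyl. \<phi>) 1 A = 1" if "finite A" for A :: "'a set"
  proof -
    interpret comp_fun_commute "\<lambda>(i :: 'a) \<phi> :: 'a weyl. \<phi>"
      by standard simp
    show ?thesis using that by induction simp_all
  qed
  from this[of UNIV] show ?thesis by (simp add: d_pow_def)
qed

text \<open>
  The factors of the fold that defines \<open>\<partial>\<^sup>\<alpha>\<close> commute, so the factor for \<open>i\<close>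
  can be taken out first; it alone sees the change of exponent.
\<close>

lemma d_pow_step: "d_pow (\<alpha> + Poly_Mapping.single i 1) = d_op i * d_pow \<alpha>"
proof -
  let ?f = "\<lambda>\<alpha> i \<phi>. d_op i ^ Poly_Mapping.lookup \<alpha> i * \<phi> :: 'a weyl"
  have comm: "comp_fun_commute_on UNIV (?f \<alpha>)" for \<alpha> :: "'a \<Rightarrow>\<^sub>0 nat"
  proof
    fix j k :: 'a
    have "d_op j ^ m * d_op k ^ n = d_op k ^ n * d_op j ^ m" for m n
      by (intro power_commuting_commutes power_commuting_commutes[symmetric] d_op_commute)
    then show "?f \<alpha> j \<circ> ?f \<alpha> k = ?f \<alpha> k \<circ> ?f \<alpha> j"
      by (simp add: fun_eq_iff flip: mult.assoc)
  qed
  let ?\<alpha>' = "\<alpha> + Poly_Mapping.single i 1"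
  have split: "d_pow \<beta> = d_op i ^ Poly_Mapping.lookup \<beta> i * Finite_Set.fold (?f \<beta>) 1 (UNIV - {i})"
    for \<beta>
    unfolding d_pow_def by (rule comp_fun_commute_on.fold_rec[OF comm]) simp_all
  have "Finite_Set.fold (?f ?\<alpha>') 1 (UNIV - {i}) = Finite_Set.fold (?f \<alpha>) 1 (UNIV - {i})"
    by (rule Finite_Set.fold_cong[OF comm comm])
       (auto simp: lookup_add lookup_single when_def)
  then show ?thesis
    unfolding split[of ?\<alpha>'] split[of \<alpha>] by (simp add: lookup_add mult.assoc)
qed

lemma d_op_d_pow: "d_op i * d_pow \<alpha> = d_pow \<alpha> * d_op i"
proof (induction \<alpha> rule: monomial_induct)
  case (step \<alpha> j)
  have "d_op i * (d_op j * d_pow \<alpha>) = d_op j * (d_op i * d_pow \<alpha>)"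
    by (simp only: d_op_commute[of i j] flip: mult.assoc)
  with step show ?case
    by (simp only: d_pow_step mult.assoc)
qed simp

text \<open>
  The commutator with \<open>z\<^sub>i\<close> acts on \<open>\<partial>\<^sup>\<alpha>\<close> as the derivation
  \<open>\<partial>/\<partial>\<xi>\<^sub>i\<close> acts on \<open>\<xi>\<^sup>\<alpha>\<close>.
\<close>

lemma d_pow_mult_op_var:
  "d_pow \<alpha> * mult_op (pvar i) = mult_op (pvar i) * d_pow \<alpha> +
     of_nat (Poly_Mapping.lookup \<alpha> i) * d_pow (\<alpha> - Poly_Mapping.single i 1)"
proof (induction \<alpha> rule: monomial_induct)
  case (step \<alpha> j)
  let ?e = "\<lambda>i. Poly_Mapping.single i (1::nat)"
  have comm: "d_op j * mult_op (pvar i) = mult_op (pvar i) * d_op j + of_bool (j = i)"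
    by (simp add: d_op_mult_op pd_pvar)
  \<comment> \<open>If \<open>\<alpha>\<close> has exponent 0 at \<open>i\<close>, the truncated exponents may differ, but the coefficient is 0.\<close>
  have shift: "of_nat (Poly_Mapping.lookup \<alpha> i) * (d_op j * d_pow (\<alpha> - ?e i)) =
      of_nat (Poly_Mapping.lookup \<alpha> i) * d_pow (\<alpha> + ?e j - ?e i)"
  proof (cases "Poly_Mapping.lookup \<alpha> i = 0")
    case False
    then have "\<alpha> - ?e i + ?e j = \<alpha> + ?e j - ?e i"
      by (intro poly_mapping_eqI) (auto simp: lookup_add lookup_minus lookup_single when_def)
    then show ?thesis by (simp flip: d_pow_step)
  qed simp
  have "d_pow (\<alpha> + ?e j) * mult_op (pvar i) = d_op j * (d_pow \<alpha> * mult_op (pvar i))"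
    by (simp only: d_pow_step mult.assoc)
  also have "\<dots> = (d_op j * mult_op (pvar i)) * d_pow \<alpha> +
      of_nat (Poly_Mapping.lookup \<alpha> i) * (d_op j * d_pow (\<alpha> - ?e i))"
    by (simp only: step.IH distrib_left mult_of_nat_commute mult.assoc)
  also have "\<dots> = mult_op (pvar i) * d_pow (\<alpha> + ?e j) + of_bool (j = i) * d_pow \<alpha> +
      of_nat (Poly_Mapping.lookup \<alpha> i) * d_pow (\<alpha> + ?e j - ?e i)"
    unfolding comm shift by (simp only: distrib_right d_pow_step mult.assoc)
  also have "\<dots> = mult_op (pvar i) * d_pow (\<alpha> + ?e j) +
      of_nat (Poly_Mapping.lookup (\<alpha> + ?e j) i) * d_pow (\<alpha> + ?e j - ?e i)"
    by (auto simp: lookup_add lookup_single algebra_simps)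
  finally show ?case .
qed simp

lemma subst_d_conv_extend: "subst_d l = extend (\<lambda>\<alpha> c. mult_op (const c) * d_pow \<alpha>) l"
  by (simp add: subst_d_def extend_def)

lemma subst_d_single: "subst_d (Poly_Mapping.single \<alpha> c) = mult_op (const c) * d_pow \<alpha>"
  unfolding subst_d_conv_extend by (simp add: extend_single)

lemma subst_d_add: "subst_d (f + g) = subst_d f + subst_d g"
  unfolding subst_d_conv_extend
  by (rule extend_add) (simp_all add: single_add mult_op_add distrib_right)

lemma subst_d_pvar_mult:
  "subst_d (pvar i * l) = d_op i * subst_d l"
  "subst_d (pvar i * l) = subst_d l * d_op i"
proof -
  have "subst_d (pvar i * l) = d_op i * subst_d l \<and> subst_d (pvar i * l) = subst_d l * d_op i"
  proof (induction l rule: poly_mapping_additive_induct)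
    case (single \<alpha> c)
    have *: "subst_d (pvar i * Poly_Mapping.single \<alpha> c) = mult_op (const c) * (d_op i * d_pow \<alpha>)"
      by (simp add: pvar_def mult_single subst_d_single add.commute[of "Poly_Mapping.single i _"]
          d_pow_step[simplified])
    have "d_op i * mult_op (const c) = mult_op (const c) * d_op i"
      by (simp add: d_op_mult_op)
    then have "d_op i * (mult_op (const c) * d_pow \<alpha>) = mult_op (const c) * (d_op i * d_pow \<alpha>)"
      by (simp only: flip: mult.assoc)
    then show ?case
      by (simp only: * subst_d_single d_op_d_pow mult.assoc)
  next
    case (add f g)
    then show ?case by (metis distrib_left distrib_right subst_d_add)
  qed
  then show "subst_d (pvar i * l) = d_op i * subst_d l" "subst_d (pvar i * l) = subst_d l * d_op i"
    by blast+
qed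

section \<open>Uniqueness of total symbols\<close>

lemma of_nat_mult_mpoly_eq_0:
  assumes "of_nat n * (p :: 'v mpoly) = 0" "n \<noteq> 0"
  shows "p = 0"
proof (rule poly_mapping_eqI)
  fix m
  have "of_nat n * p = smult (of_nat n) p"
    by (simp add: smult_conv_mult flip: single_of_nat)
  then show "Poly_Mapping.lookup p m = Poly_Mapping.lookup 0 m"
    using assms by (metis lookup_smult lookup_zero mult_eq_0_iff of_nat_eq_0_iff)
qed

text \<open>
  A coefficient family is a polynomial in \<open>\<xi>\<close> with coefficients in \<open>\<complex>[z]\<close>; its
  product is the polynomial product.
\<close>

type_synonym 'n family = "('n \<Rightarrow>\<^sub>0 nat) \<Rightarrow>\<^sub>0 'n mpoly"

text \<open>\<open>\<partial>/\<partial>\<xi>\<^sub>i\<close> with coefficients in \<open>\<complex>[z]\<close>.\<close>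

definition delta :: "'n \<Rightarrow> 'n family \<Rightarrow> 'n family" where
  "delta i = extend (\<lambda>\<alpha> p. Poly_Mapping.single (\<alpha> - Poly_Mapping.single i 1)
     (of_nat (Poly_Mapping.lookup \<alpha> i) * p))"

lemma delta_single: "delta i (Poly_Mapping.single \<alpha> p) =
    Poly_Mapping.single (\<alpha> - Poly_Mapping.single i 1) (of_nat (Poly_Mapping.lookup \<alpha> i) * p)"
  by (simp add: delta_def extend_single)

lemma delta_add: "delta i (a + b) = delta i a + delta i b"
  unfolding delta_def by (rule extend_add) (simp_all add: algebra_simps single_add)

lemma lookup_delta:
  "Poly_Mapping.lookup (delta i a) \<beta> =
     of_nat (Suc (Poly_Mapping.lookup \<beta> i)) * Poly_Mapping.lookup a (\<beta> + Poly_Mapping.single i 1)"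
proof (induction a rule: poly_mapping_additive_induct)
  case (single \<alpha> p)
  let ?e = "Poly_Mapping.single i (1::nat)"
  have "\<alpha> - ?e = \<beta> \<longleftrightarrow> \<alpha> = \<beta> + ?e" if "Poly_Mapping.lookup \<alpha> i \<noteq> 0"
  proof -
    have "\<alpha> - ?e + ?e = \<alpha>"
      by (rule poly_mapping_eqI)
         (use that in \<open>auto simp: lookup_add lookup_minus lookup_single when_def\<close>)
    then show ?thesis by (metis add_diff_cancel_right')
  qed
  moreover have "Poly_Mapping.lookup (\<beta> + ?e) i = Suc (Poly_Mapping.lookup \<beta> i)"
    by (simp add: lookup_add)
  ultimately show ?case
    by (cases "Poly_Mapping.lookup \<alpha> i = 0") (auto simp: delta_single lookup_single when_def)
qed (simp add: delta_add lookup_add distrib_left)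

definition mdeg :: "('v::finite \<Rightarrow>\<^sub>0 nat) \<Rightarrow> nat" where
  "mdeg \<alpha> = (\<Sum>i\<in>UNIV. Poly_Mapping.lookup \<alpha> i)"

lemma mdeg_step: "mdeg (\<alpha> + Poly_Mapping.single i 1) = Suc (mdeg \<alpha>)"
  by (simp add: mdeg_def lookup_add lookup_single when_def sum.distrib)

text \<open>
  All derivatives in \<open>\<xi>\<close> have smaller degree in \<open>\<xi>\<close>, so a property of a family may be
  derived from that property of its derivatives. The zero family needs a separate case: its
  derivatives are again zero.
\<close>

lemma family_degree_induct [case_names zero delta]:
  fixes a :: "'n::finite family"
  assumes zero: "P 0"
    and delta: "\<And>a. (\<And>i. P (delta i a)) \<Longrightarrow> P a"
  shows "P a"
proof -
  have "P a" if "\<forall>\<alpha>\<in>Poly_Mapping.keys a. mdeg \<alpha> < N" for N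
    using that
  proof (induction N arbitrary: a)
    case 0
    then have "a = 0" by auto
    then show ?case using zero by simp
  next
    case (Suc N)
    show ?case
    proof (rule delta, rule Suc.IH, rule ballI)
      fix i \<alpha> assume "\<alpha> \<in> Poly_Mapping.keys (delta i a)"
      then have "\<alpha> + Poly_Mapping.single i 1 \<in> Poly_Mapping.keys a"
        by (auto simp: in_keys_iff lookup_delta simp del: of_nat_Suc)
      with Suc.prems have "mdeg (\<alpha> + Poly_Mapping.single i 1) < Suc N" by blast
      then show "mdeg \<alpha> < N" by (simp add: mdeg_step[simplified])
    qed
  qed
  moreover have "\<forall>\<alpha>\<in>Poly_Mapping.keys a. mdeg \<alpha> < Suc (\<Sum>\<alpha>\<in>Poly_Mapping.keys a. mdeg \<alpha>)"
    by (auto simp: less_Suc_eq_le intro: member_le_sum)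
  ultimately show ?thesis by blast
qed

text \<open>
  Characteristic 0: a polynomial in \<open>\<xi>\<close> whose derivatives all vanish is constant in
  \<open>\<xi>\<close>.
\<close>

lemma delta_eq_0_imp_single:
  assumes "\<And>i. delta i a = 0"
  shows "a = Poly_Mapping.single 0 (Poly_Mapping.lookup a 0)"
proof (rule poly_mapping_eqI)
  fix \<alpha>
  show "Poly_Mapping.lookup a \<alpha> = Poly_Mapping.lookup (Poly_Mapping.single 0 (Poly_Mapping.lookup a 0)) \<alpha>"
  proof (cases "\<alpha> = 0")
    case False
    then obtain i where i: "Poly_Mapping.lookup \<alpha> i \<noteq> 0"
      by (metis lookup_zero poly_mapping_eqI)
    let ?\<beta> = "\<alpha> - Poly_Mapping.single i 1"
    have "?\<beta> + Poly_Mapping.single i 1 = \<alpha>"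
      by (rule poly_mapping_eqI)
         (use i in \<open>auto simp: lookup_add lookup_minus lookup_single when_def\<close>)
    then have "of_nat (Suc (Poly_Mapping.lookup ?\<beta> i)) * Poly_Mapping.lookup a \<alpha> = 0"
      using lookup_delta[of i a ?\<beta>] assms[of i] by simp
    then have "Poly_Mapping.lookup a \<alpha> = 0"
      by (rule of_nat_mult_mpoly_eq_0) simp
    then show ?thesis using False by (simp add: lookup_single when_def)
  qed simp
qed

text \<open>
  The right and the left normal form are two ways to order \<open>p\<close> and \<open>\<partial>\<^sup>\<alpha>\<close> in the
  operator \<open>q \<alpha> p\<close>. Uniqueness of coefficients uses only what they share: the
  commutator with \<open>z\<^sub>i\<close> acts as \<open>\<partial>/\<partial>\<xi>\<^sub>i\<close>.
\<close>

locale normal_ordering =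
  fixes q :: "('n::finite \<Rightarrow>\<^sub>0 nat) \<Rightarrow> 'n mpoly \<Rightarrow> 'n weyl"
  assumes add: "q \<alpha> (p + p') = q \<alpha> p + q \<alpha> p'"
    and no_derivative: "q 0 p = mult_op p"
    and commutator: "q \<alpha> p * mult_op (pvar i) - mult_op (pvar i) * q \<alpha> p =
      q (\<alpha> - Poly_Mapping.single i 1) (of_nat (Poly_Mapping.lookup \<alpha> i) * p)"
begin

lemma q_zero [simp]: "q \<alpha> 0 = 0"
  using add[of \<alpha> 0 0] by simp

lemma extend_q_add: "extend q (a + b) = extend q a + extend q b"
  by (rule extend_add) (simp_all add: add)

lemma extend_q_diff: "extend q (a - b) = extend q a - extend q b"
  using extend_q_add[of "a - b" b] by simp

lemma extend_q_single: "extend q (Poly_Mapping.single \<alpha> p) = q \<alpha> p"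
  by (simp add: extend_single)

lemma commutator_extend:
  "extend q a * mult_op (pvar i) - mult_op (pvar i) * extend q a = extend q (delta i a)"
proof (induction a rule: poly_mapping_additive_induct)
  case (single \<alpha> p)
  then show ?case by (simp add: delta_single extend_q_single commutator)
next
  case (add a b)
  then show ?case by (simp add: extend_q_add delta_add algebra_simps)
qed

text \<open>
  If the operator is 0, so are its commutators with all \<open>z\<^sub>i\<close>, which are represented by the
  derivatives of the family. By induction these derivatives vanish, hence the family is
  concentrated at the exponent 0 and the operator is a multiplication operator.
\<close>

lemma extend_q_eq_0: "extend q a = 0 \<Longrightarrow> a = 0"
proof (induction a rule: family_degree_induct)
  case (delta a)
  have "delta i a = 0" for i
    using delta.prems commutator_extend[of a i] by (intro delta.IH) simp
  then have a: "a = Poly_Mapping.single 0 (Poly_Mapping.lookup a 0)"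
    by (rule delta_eq_0_imp_single)
  have "mult_op (Poly_Mapping.lookup a 0) = extend q a"
    by (subst (2) a) (simp add: extend_q_single no_derivative)
  then have "Poly_Mapping.lookup a 0 = 0"
    using delta.prems by simp
  with a show ?case by (metis single_zero)
qed simp

lemma extend_q_inject: "extend q a = extend q b \<longleftrightarrow> a = b"
  using extend_q_eq_0[of "a - b"] by (auto simp: extend_q_diff)

end

interpretation right: normal_ordering "\<lambda>\<alpha> p. mult_op p * d_pow \<alpha>"
proof
  fix \<alpha> :: "'n::finite \<Rightarrow>\<^sub>0 nat" and p i
  have "mult_op p * d_pow \<alpha> * mult_op (pvar i) - mult_op (pvar i) * (mult_op p * d_pow \<alpha>) =
      mult_op p * (d_pow \<alpha> * mult_op (pvar i)) - mult_op p * (mult_op (pvar i) * d_pow \<alpha>)"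
    by (metis mult.assoc mult_op_commute)
  also have "\<dots> = mult_op p * (of_nat (Poly_Mapping.lookup \<alpha> i) * d_pow (\<alpha> - Poly_Mapping.single i 1))"
    unfolding d_pow_mult_op_var by (simp add: distrib_left)
  also have "\<dots> = mult_op (of_nat (Poly_Mapping.lookup \<alpha> i) * p) * d_pow (\<alpha> - Poly_Mapping.single i 1)"
    by (metis mult.assoc mult_op_commute mult_op_mult mult_op_of_nat)
  finally show "mult_op p * d_pow \<alpha> * mult_op (pvar i) - mult_op (pvar i) * (mult_op p * d_pow \<alpha>) =
      mult_op (of_nat (Poly_Mapping.lookup \<alpha> i) * p) * d_pow (\<alpha> - Poly_Mapping.single i 1)" .
qed (simp_all add: mult_op_add distrib_right)

interpretation left: normal_ordering "\<lambda>\<alpha> p. d_pow \<alpha> * mult_op p"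
proof
  fix \<alpha> :: "'n::finite \<Rightarrow>\<^sub>0 nat" and p i
  have "d_pow \<alpha> * mult_op p * mult_op (pvar i) - mult_op (pvar i) * (d_pow \<alpha> * mult_op p) =
      (d_pow \<alpha> * mult_op (pvar i)) * mult_op p - mult_op (pvar i) * d_pow \<alpha> * mult_op p"
    by (metis mult.assoc mult_op_commute)
  also have "\<dots> = d_pow (\<alpha> - Poly_Mapping.single i 1) * of_nat (Poly_Mapping.lookup \<alpha> i) * mult_op p"
    unfolding d_pow_mult_op_var by (simp add: distrib_right mult_of_nat_commute)
  also have "\<dots> = d_pow (\<alpha> - Poly_Mapping.single i 1) * mult_op (of_nat (Poly_Mapping.lookup \<alpha> i) * p)"
    by (simp add: mult_op_mult mult_op_of_nat mult.assoc)
  finally show "d_pow \<alpha> * mult_op p * mult_op (pvar i) - mult_op (pvar i) * (d_pow \<alpha> * mult_op p) =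
      d_pow (\<alpha> - Poly_Mapping.single i 1) * mult_op (of_nat (Poly_Mapping.lookup \<alpha> i) * p)" .
qed (simp_all add: mult_op_add distrib_left)

abbreviation right_op :: "'n::finite family \<Rightarrow> 'n weyl" where
  "right_op \<equiv> extend (\<lambda>\<alpha> p. mult_op p * d_pow \<alpha>)"

abbreviation left_op :: "'n::finite family \<Rightarrow> 'n weyl" where
  "left_op \<equiv> extend (\<lambda>\<alpha> p. d_pow \<alpha> * mult_op p)"

definition symbol :: "'n family \<Rightarrow> 'n var mpoly" where
  "symbol = extend (\<lambda>\<alpha> p. in_z p * in_xi (Poly_Mapping.single \<alpha> 1))"

lemma right_symbol_right_op: "right_symbol (right_op a) = symbol a"
proof -
  have "right_symbol (right_op a) = symbol (THE b. right_op a = right_op b)"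
    unfolding right_symbol_def symbol_def extend_def Let_def ..
  also have "(THE b. right_op a = right_op b) = a"
    by (rule the_equality) (simp_all only: right.extend_q_inject)
  finally show ?thesis .
qed

lemma left_symbol_left_op: "left_symbol (left_op a) = symbol a"
proof -
  have "left_symbol (left_op a) = symbol (THE b. left_op a = left_op b)"
    unfolding left_symbol_def symbol_def extend_def Let_def ..
  also have "(THE b. left_op a = left_op b) = a"
    by (rule the_equality) (simp_all only: left.extend_q_inject)
  finally show ?thesis .
qed

section \<open>Symbols of the two compositions\<close>

lemma symbol_single: "symbol (Poly_Mapping.single \<alpha> p) = in_z p * in_xi (Poly_Mapping.single \<alpha> 1)"
  by (simp add: symbol_def extend_single)

lemma symbol_add: "symbol (a + b) = symbol a + symbol b"
  unfolding symbol_def by (rule extend_add) (simp_all add: in_z_add algebra_simps)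

lemma symbol_diff: "symbol (a - b) = symbol a - symbol b"
  using symbol_add[of "a - b" b] by simp

text \<open>
  Multiplication of a family by \<open>\<xi>\<^sub>i\<close>. On the represented operators it is composition
  with \<open>\<partial>\<^sub>i\<close>, on the side where the normal form has its derivatives.
\<close>

abbreviation xi_mult :: "'n \<Rightarrow> 'n family \<Rightarrow> 'n family" where
  "xi_mult i a \<equiv> Poly_Mapping.single (Poly_Mapping.single i 1) 1 * a"

lemma xi_mult_single:
  "xi_mult i (Poly_Mapping.single \<alpha> p) = Poly_Mapping.single (\<alpha> + Poly_Mapping.single i 1) p"
  by (simp add: mult_single add.commute)

lemma symbol_xi_mult: "symbol (xi_mult i a) = pvar (Xi i) * symbol a"
proof (induction a rule: poly_mapping_additive_induct)
  case (single \<alpha> p)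
  have "Poly_Mapping.single (\<alpha> + Poly_Mapping.single i 1) 1 = pvar i * Poly_Mapping.single \<alpha> 1"
    by (simp add: pvar_def mult_single add.commute)
  then show ?case
    unfolding xi_mult_single symbol_single by (simp only: in_xi_mult in_xi_pvar mult.left_commute)
qed (simp add: symbol_add distrib_left)

lemma right_op_xi_mult: "right_op (xi_mult i a) = right_op a * d_op i"
proof (induction a rule: poly_mapping_additive_induct)
  case (single \<alpha> p)
  show ?case
    unfolding xi_mult_single right.extend_q_single d_pow_step by (simp add: d_op_d_pow mult.assoc)
qed (simp add: right.extend_q_add distrib_left distrib_right)

lemma left_op_xi_mult: "left_op (xi_mult i a) = d_op i * left_op a"
proof (induction a rule: poly_mapping_additive_induct)
  case (single \<alpha> p)
  show ?case
    unfolding xi_mult_single left.extend_q_single d_pow_step by (simp add: mult.assoc)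
qed (simp add: left.extend_q_add distrib_left)

lemma star_xi_mult:
  "star t (in_xi (pvar i * l)) (in_z p) =
     pvar (Xi i) * star t (in_xi l) (in_z p) - smult t (star t (in_xi l) (in_z (pd i p)))"
  by (simp add: in_xi_mult star_pvar_mult pd_in_z)

text \<open>
  The step for a variable uses the family \<open>\<xi>\<^sub>i a + b\<close>, where \<open>a\<close> belongs to
  \<open>p\<close> and \<open>b\<close> to \<open>\<partial>\<^sub>i p\<close>; hence the induction is over all \<open>p\<close> at
  once. The sign of \<open>b\<close> is that of \<open>\<partial>\<^sub>i p = p \<partial>\<^sub>i + (\<partial>\<^sub>i p)\<close>
  solved for the product that is not in right normal form, which is why \<open>t = -1\<close>.
\<close>

lemma right_family_exists:
  "\<exists>a. right_op a = subst_d l * mult_op p \<and> symbol a = star (-1) (in_xi l) (in_z p)"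
proof (induction l arbitrary: p rule: mpoly_induct)
  case (const c)
  show ?case
    by (rule exI[of _ "Poly_Mapping.single 0 (const c * p)"])
       (simp add: right.extend_q_single symbol_single subst_d_single mult_op_mult star_const in_z_mult)
next
  case (var i l)
  from var.IH[of p] var.IH[of "pd i p"] obtain a b where
    a: "right_op a = subst_d l * mult_op p" "symbol a = star (-1) (in_xi l) (in_z p)" and
    b: "right_op b = subst_d l * mult_op (pd i p)" "symbol b = star (-1) (in_xi l) (in_z (pd i p))"
    by blast
  have "subst_d (pvar i * l) * mult_op p = subst_d l * (d_op i * mult_op p)"
    by (simp add: subst_d_pvar_mult(2) mult.assoc)
  then have "right_op (xi_mult i a + b) = subst_d (pvar i * l) * mult_op p"
    by (simp add: right.extend_q_add right_op_xi_mult[simplified] a b d_op_mult_op distrib_left mult.assoc)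
  moreover have "symbol (xi_mult i a + b) = star (-1) (in_xi (pvar i * l)) (in_z p)"
    unfolding star_xi_mult symbol_add symbol_xi_mult a b by (simp add: smult_minus_one)
  ultimately show ?case by blast
next
  case (add f g)
  from add.IH(1)[of p] add.IH(2)[of p] obtain a b where
    "right_op a = subst_d f * mult_op p" "symbol a = star (-1) (in_xi f) (in_z p)"
    "right_op b = subst_d g * mult_op p" "symbol b = star (-1) (in_xi g) (in_z p)"
    by blast
  then show ?case
    by (intro exI[of _ "a + b"])
       (simp add: right.extend_q_add symbol_add subst_d_add in_xi_add star_add_left distrib_right)
qed

text \<open>
  Here the product to be rewritten is \<open>p \<partial>\<^sub>i = \<partial>\<^sub>i p - (\<partial>\<^sub>i p)\<close>, so the
  family is \<open>\<xi>\<^sub>i a - b\<close> and \<open>t = 1\<close>.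
\<close>

lemma left_family_exists:
  "\<exists>b. left_op b = mult_op p * subst_d l \<and> symbol b = star 1 (in_xi l) (in_z p)"
proof (induction l arbitrary: p rule: mpoly_induct)
  case (const c)
  show ?case
    by (rule exI[of _ "Poly_Mapping.single 0 (const c * p)"])
       (simp add: left.extend_q_single symbol_single subst_d_single mult_op_mult
         mult_op_commute star_const in_z_mult)
next
  case (var i l)
  from var.IH[of p] var.IH[of "pd i p"] obtain a b where
    a: "left_op a = mult_op p * subst_d l" "symbol a = star 1 (in_xi l) (in_z p)" and
    b: "left_op b = mult_op (pd i p) * subst_d l" "symbol b = star 1 (in_xi l) (in_z (pd i p))"
    by blast
  have "mult_op p * d_op i = d_op i * mult_op p - mult_op (pd i p)"
    by (simp add: d_op_mult_op)
  then have "mult_op p * subst_d (pvar i * l) = (d_op i * mult_op p - mult_op (pd i p)) * subst_d l"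
    by (simp add: subst_d_pvar_mult(1) flip: mult.assoc)
  then have "left_op (xi_mult i a - b) = mult_op p * subst_d (pvar i * l)"
    by (simp add: left.extend_q_diff left_op_xi_mult[simplified] a b left_diff_distrib mult.assoc)
  moreover have "symbol (xi_mult i a - b) = star 1 (in_xi (pvar i * l)) (in_z p)"
    unfolding star_xi_mult symbol_diff symbol_xi_mult a b by simp
  ultimately show ?case by blast
next
  case (add f g)
  from add.IH(1)[of p] add.IH(2)[of p] obtain a b where
    "left_op a = mult_op p * subst_d f" "symbol a = star 1 (in_xi f) (in_z p)"
    "left_op b = mult_op p * subst_d g" "symbol b = star 1 (in_xi g) (in_z p)"
    by blast
  then show ?case
    by (intro exI[of _ "a + b"])
       (simp add: left.extend_q_add symbol_add subst_d_add in_xi_add star_add_left distrib_left)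
qed

theorem corollary3p2:
  fixes l p :: "'n::finite mpoly"
  shows "right_symbol (subst_d l * mult_op p) = star (-1) (in_xi l) (in_z p) \<and>
         left_symbol (mult_op p * subst_d l) = star 1 (in_xi l) (in_z p)"
  by (metis right_family_exists right_symbol_right_op left_family_exists left_symbol_left_op)

end
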